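(* For every integer $d\ge 1$ there exists a constant $C>0$ depending only on $d$ such that the following holds. Let $N\ge 2$ be an integer, let $f$ be a real-valued function, not identically zero, which is $1$-periodic in each variable and belongs to $C^2([0,1]^d)$, and let $g:\mathbb{Z}_N^d\to\mathbb{R}$ be its discretization, $g(x)=f(x/N)$ for $x\in\mathbb{Z}_N^d$. Assume that $$N\|f\|_{L^2([0,1]^d)}^2\ge 4C_d\|f\|_{C^2([0,1]^d)}^2 .$$ Then $$FR(g)\le A^{\mathrm{init}}+C\,\frac{\|f\|_{C^2([0,1]^d)}}{\|f\|_{L^2([0,1]^d)}}\,S_d(N)+C\,\frac{\|f\|_{C^2([0,1]^d)}}{\|f\|_{L^2([0,1]^d)}}\,\frac1N,$$ where $$A^{\mathrm{init}}=2\,\frac{\left|\int_{[0,1]^d}f(x)\,dx\right|}{\|f\|_{L^2([0,1]^d)}},\qquad S_d(N)=\begin{cases}1,& d=1,\\ \log N,& d=2,\\ N^{d-2},& d\ge 3.\end{cases}$$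
   Context: $\mathbb{Z}_N=\mathbb{Z}/N\mathbb{Z}$. A function that is $1$-periodic in each variable and belongs to $C^k([0,1]^d)$ means a function on $\mathbb{R}^d$ that is $1$-periodic in each variable and of class $C^k$, and $\|F\|_{C^k([0,1]^d)}=\sum_{|\alpha|\le k}\sup_{[0,1]^d}|\partial^\alpha F|$. For $h:\mathbb{Z}_N^d\to\mathbb{C}$ the discrete Fourier transform is $\widehat h(m)=N^{-d/2}\sum_{x\in\mathbb{Z}_N^d}e^{-2\pi i x\cdot m/N}h(x)$, $m\in\mathbb{Z}_N^d$. The Fourier ratio is $FR(h)=\|\widehat h\|_1/\|\widehat h\|_2$ for $h\not\equiv 0$ and $FR(h)=0$ if $h\equiv0$, where $\|\widehat h\|_p=\left(\sum_{m\in\mathbb{Z}_N^d}|\widehat h(m)|^p\right)^{1/p}$. The constant $C_d>0$ is a fixed constant depending only on $d$ such that for every integer $N\ge2$ and every $F\in C^2([0,1]^d)$ that is $1$-periodic in each variable, $$\left|\frac1{N^d}\sum_{x\in\mathbb{Z}_N^d}|F(x/N)|^2-\int_{[0,1]^d}|F(u)|^2\,du\right|\le\frac{C_d}{N}\|F\|_{C^2([0,1]^d)}^2 .$$ *)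

theory Defs
  imports "HOL-Analysis.Analysis"
begin

definition periodic :: "(real^'n \<Rightarrow> real) \<Rightarrow> bool" where
  "periodic F \<longleftrightarrow> (\<forall>i x. F (x + axis i 1) = F x)"

definition partial_deriv :: "'n \<Rightarrow> (real^'n \<Rightarrow> real) \<Rightarrow> real^'n \<Rightarrow> real" where
  "partial_deriv i F x = deriv (\<lambda>t. F (x + t *\<^sub>R axis i 1)) 0"

fun class_C :: "nat \<Rightarrow> (real^'n::finite \<Rightarrow> real) \<Rightarrow> bool" where
  "class_C 0 F \<longleftrightarrow> continuous_on UNIV F"
| "class_C (Suc k) F \<longleftrightarrow> continuous_on UNIV F \<and>
     (\<forall>i. (\<forall>x. (\<lambda>t. F (x + t *\<^sub>R axis i 1)) field_differentiable at 0) \<and>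
          class_C k (partial_deriv i F))"

(* The partial derivative for a multi-index \<alpha>: differentiate along some list of directions
   in which each i occurs \<alpha> i times.  For functions of class C^k and |\<alpha>| \<le> k the
   order of differentiation, hence the choice of the list, is immaterial. *)
definition multi_deriv :: "('n \<Rightarrow> nat) \<Rightarrow> (real^'n \<Rightarrow> real) \<Rightarrow> real^'n \<Rightarrow> real" where
  "multi_deriv \<alpha> F = foldr partial_deriv (SOME is. \<forall>i. count_list is i = \<alpha> i) F"

definition C_norm :: "nat \<Rightarrow> (real^'n::finite \<Rightarrow> real) \<Rightarrow> real" where
  "C_norm k F =
     (\<Sum>\<alpha> | (\<Sum>i\<in>UNIV. \<alpha> i) \<le> k. SUP x\<in>cbox 0 1. \<bar>multi_deriv \<alpha> F x\<bar>)"

definition L2_cube_norm :: "(real^'n::finite \<Rightarrow> real) \<Rightarrow> real" where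
  "L2_cube_norm F = sqrt (integral (cbox 0 1) (\<lambda>u. \<bar>F u\<bar>\<^sup>2))"

(* The group (Z/NZ)^d, d = CARD('n), is represented by its residues in {0, ..., N-1}^d;
   only the values on this set of a function on Z^d enter the definitions below. *)
definition grid :: "nat \<Rightarrow> (int^'n) set" where
  "grid N = {x. \<forall>i. 0 \<le> x $ i \<and> x $ i < int N}"

definition grid_point :: "nat \<Rightarrow> int^'n \<Rightarrow> real^'n" where
  "grid_point N x = (\<chi> i. real_of_int (x $ i) / real N)"

definition dft :: "nat \<Rightarrow> (int^'n::finite \<Rightarrow> complex) \<Rightarrow> int^'n \<Rightarrow> complex" where
  "dft N h m = of_real (real N powr (- real CARD('n) / 2)) *
     (\<Sum>x\<in>grid N. exp (- 2 * of_real pi * \<i> * of_int (\<Sum>i\<in>UNIV. x $ i * m $ i) / of_nat N) * h x)"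

definition lp_norm :: "real \<Rightarrow> nat \<Rightarrow> (int^'n::finite \<Rightarrow> complex) \<Rightarrow> real" where
  "lp_norm p N h = (\<Sum>m\<in>grid N. cmod (h m) powr p) powr (1 / p)"

definition fourier_ratio :: "nat \<Rightarrow> (int^'n::finite \<Rightarrow> complex) \<Rightarrow> real" where
  "fourier_ratio N h =
     (if \<forall>x\<in>grid N. h x = 0 then 0 else lp_norm 1 N (dft N h) / lp_norm 2 N (dft N h))"

definition discretization :: "nat \<Rightarrow> (real^'n \<Rightarrow> real) \<Rightarrow> int^'n \<Rightarrow> real" where
  "discretization N f x = f (grid_point N x)"

definition A_init :: "(real^'n::finite \<Rightarrow> real) \<Rightarrow> real" where
  "A_init f = 2 * \<bar>integral (cbox 0 1) f\<bar> / L2_cube_norm f"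

definition S_growth :: "nat \<Rightarrow> nat \<Rightarrow> real" where
  "S_growth d N = (if d = 1 then 1 else if d = 2 then ln (real N) else real N ^ (d - 2))"

end

theory Submission
  imports Defs
begin

text \<open>
Write \<open>d\<close> for the dimension, \<open>K\<close> for the \<open>C\<^sup>2\<close> norm of \<open>f\<close>, \<open>L\<close> for its \<open>L\<^sup>2\<close> norm and \<open>g\<close> for the
discretization.

The denominator of the Fourier ratio is the \<open>l\<^sup>2\<close> norm of \<open>g\<close> by Plancherel's theorem
(\<open>lp_norm_2_dft\<close>). Its square is \<open>N\<^sup>d\<close> times the quadrature sum for \<open>L\<^sup>2\<close>, whose error is at most
\<open>L\<^sup>2 / 4\<close> under the size condition on \<open>f\<close>; hence the denominator is at least \<open>N\<^bsup>d/2\<^esup> L / 2\<close>.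

For the numerator, summation by parts shows that taking a second difference of \<open>g\<close> in direction
\<open>i\<close> multiplies the transform by \<open>- 4 (sin (\<pi> m\<^sub>i / N))\<^sup>2\<close>. As \<open>f\<close> is of class \<open>C\<^sup>2\<close>, the second
differences are at most \<open>K / N\<^sup>2\<close>, and so the Fourier coefficient at \<open>m\<close> is at most
\<open>N\<^bsup>d/2\<^esup> K / (16 w\<^sup>2)\<close> for the distance \<open>w\<close> from \<open>m\<^sub>i\<close> to the nearest multiple of \<open>N\<close>
(\<open>cmod_dft_sum_discretization_le\<close>). For each \<open>m\<close> other than 0 take \<open>i\<close> such that \<open>w\<close> is largest.
The number of frequencies with largest distance \<open>w\<close> is at most of order \<open>w\<^bsup>d-1\<^esup>\<close>, so the sum over the
nonzero frequencies is at most of order \<open>N\<^bsup>d/2\<^esup> K\<close> times the sum of \<open>w\<^bsup>d-3\<^esup>\<close> over \<open>w < N\<close>, and this last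
sum grows like \<open>S_growth d N\<close> (\<open>sum_grid_inverse_square_le\<close>). The coefficient at 0 is at most
\<open>N\<^bsup>d/2\<^esup> K\<close>, which has the same bound because \<open>S_growth d N \<ge> 1/2\<close> for \<open>N \<ge> 2\<close>.

Altogether the Fourier ratio is at most a constant times \<open>(K / L) S_growth d N\<close>, and the remaining
terms of the claimed bound are nonnegative.
\<close>

section \<open>Sums over the grid\<close>

lemma card_box_int:
  fixes B :: "'n::finite \<Rightarrow> int set"
  shows "card {m::int^'n. \<forall>j. m $ j \<in> B j} = (\<Prod>j\<in>UNIV. card (B j))"
proof -
  have "bij_betw vec_nth {m::int^'n. \<forall>j. m $ j \<in> B j} (\<Pi>\<^sub>E j\<in>UNIV. B j)"
    by (rule bij_betwI[where g = vec_lambda]) (auto simp: PiE_iff)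
  from bij_betw_same_card[OF this] show ?thesis
    by (simp add: card_PiE)
qed

lemma finite_grid [simp]: "finite (grid N :: (int^'n::finite) set)"
proof -
  have "finite (vec_lambda ` (\<Pi>\<^sub>E j\<in>(UNIV::'n set). {0..<int N}))"
    by (intro finite_imageI finite_PiE) auto
  moreover have "(grid N :: (int^'n) set) \<subseteq> vec_lambda ` (\<Pi>\<^sub>E j\<in>(UNIV::'n set). {0..<int N})"
  proof
    fix x :: "int^'n" assume "x \<in> grid N"
    hence "vec_nth x \<in> (\<Pi>\<^sub>E j\<in>(UNIV::'n set). {0..<int N})" by (auto simp: grid_def)
    thus "x \<in> vec_lambda ` (\<Pi>\<^sub>E j\<in>(UNIV::'n set). {0..<int N})"
      by (metis image_eqI vec_nth_inverse)
  qed
  ultimately show ?thesis by (rule finite_subset[rotated])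
qed

lemma card_grid: "card (grid N :: (int^'n::finite) set) = N ^ CARD('n)"
proof -
  have "(grid N :: (int^'n) set) = {m. \<forall>j. m $ j \<in> {0..<int N}}" by (auto simp: grid_def)
  thus ?thesis using card_box_int[of "\<lambda>_::'n. {0..<int N}"] by simp
qed

text \<open>The grid stands for the group \<open>(\<int> / N \<int>)\<^sup>d\<close>, and this is the translation invariance of its
counting measure. The orthogonality of characters and the summation by parts below both come
from it.\<close>

lemma sum_grid_shift:
  fixes H :: "int^'n::finite \<Rightarrow> 'a::comm_monoid_add"
  assumes "N > 0" and per: "\<And>x. H (x + axis i (int N)) = H x"
  shows "(\<Sum>x\<in>grid N. H (x + axis i 1)) = (\<Sum>x\<in>grid N. H x)"
proof -
  have per': "H (x - axis i (int N)) = H x" for x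
    using per[of "x - axis i (int N)"] by simp
  show ?thesis
  proof (rule sum.reindex_bij_witness[where
        j = "\<lambda>x. if x $ i = int N - 1 then x + axis i 1 - axis i (int N) else x + axis i 1" and
        i = "\<lambda>x. if x $ i = 0 then x + axis i (int N) - axis i 1 else x - axis i 1"])
    fix x :: "int^'n" assume x: "x \<in> grid N"
    show "(if x $ i = int N - 1 then x + axis i 1 - axis i (int N) else x + axis i 1) \<in> grid N"
      unfolding grid_def
    proof (intro CollectI allI)
      fix k
      have "0 \<le> x $ k \<and> x $ k < int N" using x by (simp add: grid_def)
      thus "0 \<le> (if x $ i = int N - 1 then x + axis i 1 - axis i (int N) else x + axis i 1) $ k \<and>
        (if x $ i = int N - 1 then x + axis i 1 - axis i (int N) else x + axis i 1) $ k < int N"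
        by (cases "k = i") (auto simp: axis_def)
    qed
  next
    fix x :: "int^'n" assume x: "x \<in> grid N"
    show "(if x $ i = 0 then x + axis i (int N) - axis i 1 else x - axis i 1) \<in> grid N"
      unfolding grid_def
    proof (intro CollectI allI)
      fix k
      have "0 \<le> x $ k \<and> x $ k < int N" using x by (simp add: grid_def)
      thus "0 \<le> (if x $ i = 0 then x + axis i (int N) - axis i 1 else x - axis i 1) $ k \<and>
        (if x $ i = 0 then x + axis i (int N) - axis i 1 else x - axis i 1) $ k < int N"
        by (cases "k = i") (auto simp: axis_def)
    qed
  next
    fix x :: "int^'n" assume x: "x \<in> grid N"
    show "H ((if x $ i = int N - 1 then x + axis i 1 - axis i (int N) else x + axis i 1))
        = H (x + axis i 1)"
      by (simp add: per')
  next
    fix x :: "int^'n" assume x: "x \<in> grid N"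
    hence "0 \<le> x $ i" "x $ i < int N" by (auto simp: grid_def)
    thus "(\<lambda>x. if x $ i = 0 then x + axis i (int N) - axis i 1 else x - axis i 1)
        (if x $ i = int N - 1 then x + axis i 1 - axis i (int N) else x + axis i 1) = x"
      by auto
  next
    fix x :: "int^'n" assume x: "x \<in> grid N"
    hence "0 \<le> x $ i" "x $ i < int N" by (auto simp: grid_def)
    thus "(\<lambda>x. if x $ i = int N - 1 then x + axis i 1 - axis i (int N) else x + axis i 1)
        (if x $ i = 0 then x + axis i (int N) - axis i 1 else x - axis i 1) = x"
      by auto
  qed
qed

section \<open>Characters and Plancherel's theorem\<close>

text \<open>\<open>dchar N x m\<close> is the value at \<open>x\<close> of the character with frequency \<open>-m\<close>. Working with the
unnormalised transform \<open>dft_sum\<close> keeps the factor \<open>N\<^bsup>-d/2\<^esup>\<close> out of the estimates until the two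
norms are compared.\<close>

definition dchar :: "nat \<Rightarrow> int^'n::finite \<Rightarrow> int^'n \<Rightarrow> complex" where
  "dchar N x m = cis (- 2 * pi * real_of_int (\<Sum>i\<in>UNIV. x $ i * m $ i) / real N)"

definition dft_sum :: "nat \<Rightarrow> (int^'n::finite \<Rightarrow> complex) \<Rightarrow> int^'n \<Rightarrow> complex" where
  "dft_sum N h m = (\<Sum>x\<in>grid N. dchar N x m * h x)"

lemma norm_dchar [simp]: "cmod (dchar N x m) = 1"
  by (simp add: dchar_def)

lemma dft_eq: "dft N h (m::int^'n::finite) = of_real (real N powr (- real CARD('n) / 2)) * dft_sum N h m"
proof -
  have "exp (- 2 * of_real pi * \<i> * of_int (\<Sum>i\<in>UNIV. x $ i * m $ i) / of_nat N) = dchar N x m" for x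
    by (simp add: dchar_def cis_conv_exp mult_ac)
  thus ?thesis by (simp add: dft_def dft_sum_def)
qed

lemma dchar_commute: "dchar N x m = dchar N m x"
  by (simp add: dchar_def mult.commute)

lemma dchar_diff: "dchar N (x - y) m = dchar N x m * cnj (dchar N y m)"
  by (simp add: dchar_def cis_mult cis_cnj left_diff_distrib sum_subtractf
      diff_divide_distrib right_diff_distrib)

lemma dchar_add_axis:
  "dchar N (x + axis i k) m = dchar N x m * cis (- 2 * pi * of_int (k * m $ i) / real N)"
proof -
  have "(\<Sum>j\<in>UNIV. (x + axis i k) $ j * m $ j) = (\<Sum>j\<in>UNIV. x $ j * m $ j) + k * m $ i"
    by (simp add: axis_def distrib_right sum.distrib if_distrib[of "\<lambda>u. u * _"] cong: if_cong)
  thus ?thesis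
    unfolding dchar_def cis_mult by (simp add: distrib_left add_divide_distrib diff_divide_distrib)
qed

lemma dchar_periodic:
  assumes "N > 0"
  shows "dchar N (x + axis i (int N)) m = dchar N x m"
proof -
  have "- 2 * pi * of_int (int N * m $ i) / real N = 2 * pi * of_int (- m $ i)"
    using assms by simp
  hence "cis (- 2 * pi * of_int (int N * m $ i) / real N) = 1"
    by (metis cis_multiple_2pi Ints_of_int)
  thus ?thesis by (simp add: dchar_add_axis)
qed

text \<open>The summand is itself a character in \<open>m\<close>, given by \<open>z = x - y\<close>. A unit shift of \<open>m\<close> in a
direction in which \<open>x\<close> and \<open>y\<close> differ multiplies the sum by a root of unity other than 1, and
translation invariance says that the sum does not change, so it vanishes.\<close>

lemma dchar_orthogonal:
  fixes x y :: "int^'n::finite"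
  assumes N: "N > 0" and "x \<in> grid N" "y \<in> grid N" "x \<noteq> y"
  shows "(\<Sum>m\<in>grid N. dchar N x m * cnj (dchar N y m)) = 0"
proof -
  obtain i where i: "x $ i \<noteq> y $ i" using \<open>x \<noteq> y\<close> by (auto simp: vec_eq_iff)
  define z where "z = x - y"
  define w where "w = cis (- 2 * pi * of_int (z $ i) / real N)"
  have z: "z $ i \<noteq> 0" "\<bar>z $ i\<bar> < int N"
    using assms(2,3) i by (auto simp: z_def grid_def abs_less_iff) (smt (verit))+
  have "w \<noteq> 1"
  proof
    assume "w = 1"
    hence "cos (2 * pi * of_int (z $ i) / real N) = 1" 
      by (simp add: w_def complex_eq_iff)
    then obtain k :: int where "2 * pi * of_int (z $ i) / real N = k * (2 * pi)"
      by (auto simp: cos_one_2pi_int)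
    hence "of_int (z $ i) = (of_int (k * int N) :: real)" using N by (simp add: field_simps)
    hence "z $ i = k * int N" by linarith
    \<comment> \<open>Only multiples of \<open>N\<close> give 1, but coordinates of two grid points differ by less.\<close>
    hence "int N dvd z $ i" by simp
    with z show False using dvd_imp_le_int[of "z $ i" "int N"] by simp
  qed
  have "(\<Sum>m\<in>grid N. dchar N z m) = (\<Sum>m\<in>grid N. dchar N z (m + axis i 1))"
    by (rule sum_grid_shift[symmetric, OF N])
       (simp only: dchar_commute[of N z] dchar_periodic[OF N])
  also have "\<dots> = (\<Sum>m\<in>grid N. dchar N z m) * w"
    by (simp add: dchar_commute[of N z] dchar_add_axis sum_distrib_right w_def)
  finally have "(\<Sum>m\<in>grid N. dchar N z m) = 0"
    using \<open>w \<noteq> 1\<close> by simp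
  thus ?thesis by (simp add: z_def dchar_diff)
qed

lemma dft_sum_Plancherel:
  fixes h :: "int^'n::finite \<Rightarrow> complex"
  assumes N: "N > 0"
  shows "(\<Sum>m\<in>grid N. (cmod (dft_sum N h m))\<^sup>2) = real N ^ CARD('n) * (\<Sum>x\<in>grid N. (cmod (h x))\<^sup>2)"
proof -
  have "complex_of_real (\<Sum>m\<in>grid N. (cmod (dft_sum N h m))\<^sup>2)
      = (\<Sum>m\<in>grid N. dft_sum N h m * cnj (dft_sum N h m))"
    by (simp only: of_real_sum complex_norm_square)
  also have "\<dots> = (\<Sum>m\<in>grid N. \<Sum>x\<in>grid N. \<Sum>y\<in>grid N.
        (h x * cnj (h y)) * (dchar N x m * cnj (dchar N y m)))"
    by (simp add: dft_sum_def sum_product mult_ac)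
  also have "\<dots> = (\<Sum>x\<in>grid N. \<Sum>y\<in>grid N. \<Sum>m\<in>grid N.
        (h x * cnj (h y)) * (dchar N x m * cnj (dchar N y m)))"
    by (subst sum.swap, rule sum.cong[OF refl], rule sum.swap)
  also have "\<dots> = (\<Sum>x\<in>grid N. \<Sum>y\<in>grid N. 
        if y = x then of_nat (N ^ CARD('n)) * (h x * cnj (h x)) else 0)"
  proof (intro sum.cong refl)
    fix x y :: "int^'n" assume xy: "x \<in> grid N" "y \<in> grid N"
    show "(\<Sum>m\<in>grid N. (h x * cnj (h y)) * (dchar N x m * cnj (dchar N y m)))
       = (if y = x then of_nat (N ^ CARD('n)) * (h x * cnj (h x)) else 0)"
      using dchar_orthogonal[OF N xy]
      by (auto simp: sum_distrib_left[symmetric] complex_norm_square[symmetric] card_grid)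
  qed
  also have "\<dots> = of_real (real N ^ CARD('n) * (\<Sum>x\<in>grid N. (cmod (h x))\<^sup>2))"
    by (simp add: sum_distrib_left complex_norm_square[symmetric])
  finally show ?thesis by (simp only: of_real_eq_iff)
qed

lemma lp_norm_2_dft:
  fixes h :: "int^'n::finite \<Rightarrow> complex"
  assumes N: "N > 0"
  shows "lp_norm 2 N (dft N h) = sqrt (\<Sum>x\<in>grid N. (cmod (h x))\<^sup>2)"
proof -
  have *: "(real N powr (- real CARD('n) / 2))\<^sup>2 * real N ^ CARD('n) = 1"
    using N by (simp add: power2_eq_square flip: powr_realpow powr_add)
  have "(\<Sum>m\<in>grid N. (cmod (dft N h m))\<^sup>2) = (\<Sum>x\<in>grid N. (cmod (h x))\<^sup>2)"
    using dft_sum_Plancherel[OF N, of h] *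
    by (simp add: dft_eq norm_mult power_mult_distrib sum_distrib_left[symmetric]
        mult.assoc[symmetric])
  thus ?thesis by (simp add: lp_norm_def powr_half_sqrt sum_nonneg)
qed

lemma lp_norm_1_dft:
  fixes h :: "int^'n::finite \<Rightarrow> complex"
  shows "lp_norm 1 N (dft N h)
    = real N powr (- real CARD('n) / 2) * (\<Sum>m\<in>grid N. cmod (dft_sum N h m))"
  by (simp add: lp_norm_def dft_eq norm_mult sum_distrib_left sum_nonneg)

text \<open>Summation by parts: the second difference acts on the Fourier side as multiplication by
\<open>2 cos t - 2 = - 4 (sin (t / 2))\<^sup>2\<close>, where \<open>t = 2 \<pi> m\<^sub>i / N\<close>.\<close>

lemma dft_sum_second_difference:
  fixes h :: "int^'n::finite \<Rightarrow> complex"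
  assumes N: "N > 0" and per: "\<And>x. h (x + axis i (int N)) = h x"
  shows "dft_sum N (\<lambda>x. h (x + axis i 1) - 2 * h x + h (x - axis i 1)) m
    = - 4 * (sin (pi * of_int (m $ i) / real N))\<^sup>2 * dft_sum N h m"
proof -
  define t where "t = 2 * pi * of_int (m $ i) / real N"
  have step: "dchar N (x + axis i 1) m = dchar N x m * cis (- t)" for x
    by (simp add: dchar_add_axis t_def)
  have 1: "(\<Sum>x\<in>grid N. dchar N x m * h (x + axis i 1)) = cis t * dft_sum N h m"
  proof -
    have "(\<Sum>x\<in>grid N. dchar N x m * h (x + axis i 1))
       = (\<Sum>x\<in>grid N. cis t * (dchar N (x + axis i 1) m * h (x + axis i 1)))"
    proof (rule sum.cong[OF refl])
      fix x
      have "cis t * cis (- t) = 1" by (simp add: cis_mult)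
      thus "dchar N x m * h (x + axis i 1)
          = cis t * (dchar N (x + axis i 1) m * h (x + axis i 1))"
        unfolding step by algebra
    qed
    also have "\<dots> = cis t * (\<Sum>x\<in>grid N. dchar N (x + axis i 1) m * h (x + axis i 1))"
      by (simp add: sum_distrib_left)
    also have "(\<Sum>x\<in>grid N. dchar N (x + axis i 1) m * h (x + axis i 1)) = dft_sum N h m"
      unfolding dft_sum_def by (rule sum_grid_shift[OF N]) (simp add: per dchar_periodic[OF N])
    finally show ?thesis .
  qed
  have 2: "(\<Sum>x\<in>grid N. dchar N x m * h (x - axis i 1)) = cis (- t) * dft_sum N h m"
  proof -
    have "h (x + axis i (int N) - axis i 1) = h (x - axis i 1)" for x
      using per[of "x - axis i 1"] by (simp add: algebra_simps)
    hence "(\<Sum>x\<in>grid N. dchar N x m * h (x - axis i 1))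
       = (\<Sum>x\<in>grid N. dchar N (x + axis i 1) m * h (x + axis i 1 - axis i 1))"
      by (intro sum_grid_shift[OF N, symmetric]) (simp add: dchar_periodic[OF N])
    thus ?thesis by (simp add: step dft_sum_def sum_distrib_left mult_ac)
  qed
  have "cis t - 2 + cis (- t) = of_real (2 * cos t - 2)"
    by (simp add: complex_eq_iff)
  also have "2 * cos t - 2 = - 4 * (sin (pi * of_int (m $ i) / real N))\<^sup>2"
    using cos_double_sin[of "t / 2"] by (simp add: t_def mult.assoc)
  finally have 3: "cis t - 2 + cis (- t) = of_real (- 4 * (sin (pi * of_int (m $ i) / real N))\<^sup>2)" .
  have "dft_sum N (\<lambda>x. h (x + axis i 1) - 2 * h x + h (x - axis i 1)) m
     = (\<Sum>x\<in>grid N. dchar N x m * h (x + axis i 1)) - 2 * dft_sum N h m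
         + (\<Sum>x\<in>grid N. dchar N x m * h (x - axis i 1))"
    by (simp add: dft_sum_def distrib_left right_diff_distrib sum.distrib sum_subtractf
        sum_distrib_left mult.left_commute)
  also have "\<dots> = (cis t - 2 + cis (- t)) * dft_sum N h m"
    unfolding 1 2 by (simp add: algebra_simps)
  finally show ?thesis by (simp add: 3)
qed

section \<open>The norm of continuously differentiable functions and second differences\<close>

lemma class_C_imp_continuous: "class_C k F \<Longrightarrow> continuous_on UNIV F"
  by (cases k) auto

lemma class_C_foldr_partial_deriv:
  "class_C (length is + k) F \<Longrightarrow> class_C k (foldr partial_deriv is F)"
proof (induction "is" arbitrary: k)
  case (Cons i "is")
  hence "class_C (length is + Suc k) F" by simp
  from Cons.IH[OF this] show ?case by simp
qed simp

lemma ex_list_count: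
  fixes \<alpha> :: "'n::finite \<Rightarrow> nat"
  shows "\<exists>is. \<forall>i. count_list is i = \<alpha> i"
proof -
  obtain "is" where "mset is = Abs_multiset \<alpha>" using ex_mset by blast
  hence "count_list is i = \<alpha> i" for i
    by (metis count_Abs_multiset count_mset finite_code)
  thus ?thesis by blast
qed

text \<open>Whatever list of directions is chosen, it has length \<open>|\<alpha>| \<le> k\<close>, and each differentiation uses
up one degree of smoothness. The continuity makes the suprema in \<open>C_norm\<close> meaningful: the
supremum of an unbounded set of reals would be an unspecified number.\<close>

lemma multi_deriv_continuous:
  fixes F :: "real^'n::finite \<Rightarrow> real"
  assumes "class_C k F" "(\<Sum>i\<in>UNIV. \<alpha> i) \<le> k"
  shows "continuous_on UNIV (multi_deriv \<alpha> F)"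
proof -
  define "is" where "is = (SOME is. \<forall>i. count_list is i = \<alpha> i)"
  have c: "\<forall>i. count_list is i = \<alpha> i"
    unfolding is_def by (rule someI_ex[OF ex_list_count])
  have "length is = (\<Sum>i\<in>UNIV. \<alpha> i)"
    using sum_count_set[of "is" UNIV] c by simp
  hence "class_C (length is + (k - length is)) F" using assms by simp
  from class_C_foldr_partial_deriv[OF this] show ?thesis
    unfolding multi_deriv_def is_def[symmetric] by (rule class_C_imp_continuous)
qed

text \<open>For the multi-index \<open>n e\<^sub>i\<close> there is only one list of directions to choose from, so the choice
in \<open>multi_deriv\<close> can be evaluated.\<close>

lemma multi_deriv_replicate:
  "multi_deriv (\<lambda>j. if j = i then n else 0) F = foldr partial_deriv (replicate n i) F"
proof -
  have "is = replicate n i"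
    if c: "\<forall>j. count_list is j = (if j = i then n else 0)" for "is"
  proof -
    have "\<forall>j\<in>set is. j = i" 
      using c by (metis count_list_0_iff)
    hence "is = replicate (length is) i" 
      by (simp add: replicate_length_same)
    moreover have "count_list (replicate m i) i = m" for m by (induction m) auto
    ultimately show ?thesis using c by (metis (full_types))
  qed
  moreover have "\<forall>j. count_list (replicate n i) j = (if j = i then n else 0)"
    by (induction n) auto
  ultimately have "(SOME is. \<forall>j. count_list is j = (if j = i then n else 0)) = replicate n i"
    by (intro some_equality) blast+
  thus ?thesis by (simp add: multi_deriv_def)
qed

lemma finite_multi_indices: "finite {\<alpha>::'n::finite \<Rightarrow> nat. (\<Sum>i\<in>UNIV. \<alpha> i) \<le> k}"
proof (rule finite_subset)
  show "{\<alpha>::'n \<Rightarrow> nat. (\<Sum>i\<in>UNIV. \<alpha> i) \<le> k} \<subseteq> (\<Pi>\<^sub>E i\<in>UNIV. {..k})"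
  proof (rule subsetI)
    fix \<alpha> :: "'n \<Rightarrow> nat" assume "\<alpha> \<in> {\<alpha>. (\<Sum>i\<in>UNIV. \<alpha> i) \<le> k}"
    moreover have "\<alpha> i \<le> (\<Sum>i\<in>UNIV. \<alpha> i)" for i by (rule member_le_sum) auto
    ultimately have "\<alpha> i \<le> k" for i using order_trans by blast
    thus "\<alpha> \<in> (\<Pi>\<^sub>E i\<in>UNIV. {..k})" by auto
  qed
  show "finite (\<Pi>\<^sub>E i\<in>(UNIV::'n set). {..k})" by (intro finite_PiE) auto
qed

lemma abs_le_SUP_cube:
  fixes G :: "real^'n::finite \<Rightarrow> real"
  assumes "continuous_on UNIV G" "x \<in> cbox 0 1"
  shows "\<bar>G x\<bar> \<le> (SUP x\<in>cbox 0 1. \<bar>G x\<bar>)"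
proof (rule cSUP_upper[OF assms(2)])
  have "continuous_on (cbox 0 1) (\<lambda>x. \<bar>G x\<bar>)"
    using continuous_on_subset[OF assms(1)] by (intro continuous_intros) auto
  thus "bdd_above ((\<lambda>x. \<bar>G x\<bar>) ` cbox 0 1)"
    by (intro bounded_imp_bdd_above compact_imp_bounded compact_continuous_image compact_cbox)
qed

text \<open>One summand is at most the whole sum because all suprema are nonnegative.\<close>

lemma abs_multi_deriv_le_C_norm:
  fixes F :: "real^'n::finite \<Rightarrow> real"
  assumes F: "class_C k F" and \<alpha>: "(\<Sum>i\<in>UNIV. \<alpha> i) \<le> k" and x: "x \<in> cbox 0 1"
  shows "\<bar>multi_deriv \<alpha> F x\<bar> \<le> C_norm k F"
proof -
  have nonneg: "0 \<le> (SUP x\<in>cbox 0 1. \<bar>multi_deriv \<beta> F x\<bar>)"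
    if "\<beta> \<in> {\<beta>. (\<Sum>i\<in>UNIV. \<beta> i) \<le> k}" for \<beta>
    using abs_le_SUP_cube[OF multi_deriv_continuous[OF F, of \<beta>] x] that by fastforce
  have "\<bar>multi_deriv \<alpha> F x\<bar> \<le> (SUP x\<in>cbox 0 1. \<bar>multi_deriv \<alpha> F x\<bar>)"
    by (rule abs_le_SUP_cube[OF multi_deriv_continuous[OF F \<alpha>] x])
  also have "\<dots> \<le> C_norm k F"
    unfolding C_norm_def
    by (rule member_le_sum) (use \<alpha> nonneg finite_multi_indices in auto)
  finally show ?thesis .
qed

lemma abs_pure_deriv_le_C_norm:
  fixes F :: "real^'n::finite \<Rightarrow> real"
  assumes "class_C k F" "n \<le> k" "x \<in> cbox 0 1"
  shows "\<bar>foldr partial_deriv (replicate n i) F x\<bar> \<le> C_norm k F"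
proof -
  have "(\<Sum>j\<in>UNIV. if j = i then n else 0) \<le> k" using assms(2) by simp
  from abs_multi_deriv_le_C_norm[OF assms(1) this assms(3)] show ?thesis
    by (simp only: multi_deriv_replicate)
qed

lemma abs_le_C_norm:
  fixes F :: "real^'n::finite \<Rightarrow> real"
  assumes "class_C k F" "x \<in> cbox 0 1"
  shows "\<bar>F x\<bar> \<le> C_norm k F"
  using abs_pure_deriv_le_C_norm[OF assms(1) _ assms(2), of 0] by simp

lemma C_norm_nonneg:
  fixes F :: "real^'n::finite \<Rightarrow> real"
  assumes "class_C k F"
  shows "0 \<le> C_norm k F"
proof -
  have "(0::real^'n) \<in> cbox 0 1" by (simp add: mem_box_cart)
  from abs_le_C_norm[OF assms this] show ?thesis by linarith
qed

lemma abs_pure_second_deriv_le_C_norm: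
  fixes F :: "real^'n::finite \<Rightarrow> real"
  assumes "class_C 2 F" "x \<in> cbox 0 1"
  shows "\<bar>partial_deriv i (partial_deriv i F) x\<bar> \<le> C_norm 2 F"
  using abs_pure_deriv_le_C_norm[OF assms(1) order.refl assms(2), of i]
  by (simp add: numeral_2_eq_2)

lemma partial_deriv_periodic:
  fixes F :: "real^'n::finite \<Rightarrow> real"
  assumes "periodic F"
  shows "periodic (partial_deriv i F)"
proof -
  have "F (x + axis j 1 + t *\<^sub>R axis i 1) = F (x + t *\<^sub>R axis i 1)" for x t j
    using assms[unfolded periodic_def, rule_format, of "x + t *\<^sub>R axis i 1" j]
    by (simp add: add_ac)
  thus ?thesis by (simp add: periodic_def partial_deriv_def)
qed

lemma line_deriv:
  fixes F :: "real^'n::finite \<Rightarrow> real"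
  assumes "class_C (Suc k) F"
  shows "((\<lambda>t. F (x + t *\<^sub>R axis i 1)) has_real_derivative
            partial_deriv i F (x + t *\<^sub>R axis i 1)) (at t)"
proof -
  have "(\<lambda>s. F ((x + t *\<^sub>R axis i 1) + s *\<^sub>R axis i 1)) field_differentiable at 0"
    using assms by auto
  hence "((\<lambda>s. F ((x + t *\<^sub>R axis i 1) + s *\<^sub>R axis i 1)) has_real_derivative
      partial_deriv i F (x + t *\<^sub>R axis i 1)) (at 0)"
    unfolding partial_deriv_def by (rule field_differentiable_derivI)
  moreover have "(x + t *\<^sub>R axis i 1) + s *\<^sub>R axis i 1 = x + (s + t) *\<^sub>R axis i (1::real)" for s
    by (simp add: scaleR_add_left add_ac)
  ultimately show ?thesis
    using DERIV_shift[of "\<lambda>t. F (x + t *\<^sub>R axis i 1)" _ 0 t] by simp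
qed

text \<open>Add the Taylor expansions at 0 with Lagrange remainder of \<open>\<phi> h\<close> and \<open>\<phi> (- h)\<close>; the first
order terms cancel.\<close>

lemma second_difference_le:
  fixes \<phi> :: "real \<Rightarrow> real"
  assumes 1: "\<And>t. (\<phi> has_real_derivative \<phi>' t) (at t)"
    and 2: "\<And>t. (\<phi>' has_real_derivative \<phi>'' t) (at t)"
    and K: "\<And>t. \<bar>t\<bar> \<le> \<bar>h\<bar> \<Longrightarrow> \<bar>\<phi>'' t\<bar> \<le> K"
  shows "\<bar>\<phi> h - 2 * \<phi> 0 + \<phi> (- h)\<bar> \<le> K * h\<^sup>2"
proof -
  define diff where "diff = (\<lambda>n::nat. if n = 0 then \<phi> else if n = 1 then \<phi>' else \<phi>'')"
  have D: "\<forall>m t. m < 2 \<and> \<bar>t\<bar> \<le> \<bar>x\<bar> \<longrightarrow> DERIV (diff m) t :> diff (Suc m) t" for x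
    using 1 2 by (auto simp: diff_def less_2_cases_iff)
  have T: "\<exists>t. \<bar>t\<bar> \<le> \<bar>x\<bar> \<and> \<phi> x = \<phi> 0 + \<phi>' 0 * x + \<phi>'' t / 2 * x\<^sup>2" for x
    using Maclaurin_bi_le[OF _ D, of \<phi> x] by (simp add: diff_def numeral_2_eq_2)
  obtain s where s: "\<bar>s\<bar> \<le> \<bar>h\<bar>" "\<phi> h = \<phi> 0 + \<phi>' 0 * h + \<phi>'' s / 2 * h\<^sup>2"
    using T[of h] by blast
  obtain t where t: "\<bar>t\<bar> \<le> \<bar>h\<bar>" "\<phi> (-h) = \<phi> 0 - \<phi>' 0 * h + \<phi>'' t / 2 * h\<^sup>2"
    using T[of "-h"] by auto
  have "\<phi> h - 2 * \<phi> 0 + \<phi> (- h) = (\<phi>'' s + \<phi>'' t) / 2 * h\<^sup>2"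
    by (simp only: s(2) t(2)) (simp add: algebra_simps add_divide_distrib)
  moreover have "\<bar>(\<phi>'' s + \<phi>'' t) / 2\<bar> \<le> K" using K[OF s(1)] K[OF t(1)] by (simp add: abs_le_iff)
  ultimately show ?thesis by (simp only: abs_mult abs_power2 mult_right_mono zero_le_power2)
qed

lemma grid_point_in_cube:
  assumes "N > 0" "x \<in> grid N"
  shows "grid_point N x \<in> cbox 0 1"
  using assms by (auto simp: grid_def grid_point_def mem_box_cart field_simps)
     (metis less_imp_le of_int_le_iff of_int_of_nat_eq)

lemma grid_point_add_axis:
  "grid_point N (x + axis i k) = grid_point N x + (of_int k / real N) *\<^sub>R axis i 1"
  by (simp add: grid_point_def vec_eq_iff axis_def add_divide_distrib)

lemma discretization_periodic:
  assumes "N > 0" "periodic f"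
  shows "discretization N f (x + axis i (int N)) = discretization N f x"
  using assms by (simp add: discretization_def grid_point_add_axis periodic_def)

text \<open>The segment from \<open>x/N - e\<^sub>i/N\<close> to \<open>x/N + e\<^sub>i/N\<close> may leave the unit cube through the face
\<open>u\<^sub>i = 0\<close>, but no other. There the bound on the second derivative, which \<open>C_norm\<close> only gives
on the cube, is carried over by periodicity.\<close>

lemma discretization_second_difference_le:
  fixes f :: "real^'n::finite \<Rightarrow> real"
  assumes N: "N > 0" and f: "class_C 2 f" and per: "periodic f" and x: "x \<in> grid N"
  shows "\<bar>discretization N f (x + axis i 1) - 2 * discretization N f x
           + discretization N f (x - axis i 1)\<bar> \<le> C_norm 2 f / (real N)\<^sup>2"
proof -
  define p where "p = grid_point N x"
  define \<phi> where "\<phi> = (\<lambda>t. f (p + t *\<^sub>R axis i 1))"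
  define f2 where "f2 = partial_deriv i (partial_deriv i f)"
  have f': "class_C (Suc (Suc 0)) f" "class_C (Suc 0) (partial_deriv i f)"
    using f by (auto simp: numeral_2_eq_2)
  have bound: "\<bar>f2 (p + t *\<^sub>R axis i 1)\<bar> \<le> C_norm 2 f" if t: "\<bar>t\<bar> \<le> \<bar>1 / real N\<bar>" for t
  proof -
    have pj: "0 \<le> p $ j" "p $ j \<le> 1 - 1 / real N" for j
    proof -
      have "0 \<le> x $ j" "x $ j \<le> int N - 1" using x by (auto simp: grid_def)
      hence "0 \<le> real_of_int (x $ j)" "real_of_int (x $ j) \<le> real N - 1" by linarith+
      thus "0 \<le> p $ j" "p $ j \<le> 1 - 1 / real N"
        using N by (auto simp: p_def grid_point_def field_simps)
    qed
    have N1: "0 \<le> 1 / real N" "1 / real N \<le> 1" using N by auto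
    have pj1: "p $ j \<le> 1" for j using pj(2)[of j] N1 by linarith
    define q where "q = p + t *\<^sub>R axis i 1"
    have q: "q $ j = p $ j + (if j = i then t else 0)" for j by (simp add: q_def axis_def)
    show ?thesis
    proof (cases "q $ i \<ge> 0")
      case True
      have "0 \<le> q $ j \<and> q $ j \<le> 1" for j
        using True pj[of j] pj1[of j] t N1 by (cases "j = i") (auto simp: q)
      hence "q \<in> cbox 0 1" by (simp add: mem_box_cart)
      thus ?thesis unfolding f2_def q_def[symmetric] by (rule abs_pure_second_deriv_le_C_norm[OF f])
    next
      case False
      have "0 \<le> (q + axis i 1) $ j \<and> (q + axis i 1) $ j \<le> 1" for j
        using False pj[of j] pj1[of j] t N1 q[of j] by (cases "j = i") (auto simp: axis_def)
      hence "q + axis i 1 \<in> cbox 0 1" by (simp add: mem_box_cart)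
      hence "\<bar>f2 (q + axis i 1)\<bar> \<le> C_norm 2 f"
        unfolding f2_def by (rule abs_pure_second_deriv_le_C_norm[OF f])
      moreover have "periodic f2"
        unfolding f2_def by (intro partial_deriv_periodic per)
      ultimately show ?thesis by (simp add: periodic_def q_def)
    qed
  qed
  have "\<bar>\<phi> (1 / real N) - 2 * \<phi> 0 + \<phi> (- (1 / real N))\<bar> \<le> C_norm 2 f * (1 / real N)\<^sup>2"
    unfolding \<phi>_def
    by (rule second_difference_le[OF line_deriv[OF f'(1)] line_deriv[OF f'(2)]])
       (use bound in \<open>simp add: f2_def\<close>)
  moreover have "discretization N f (x + axis i 1) = \<phi> (1 / real N)"
     "discretization N f x = \<phi> 0"
    by (simp_all add: discretization_def grid_point_add_axis \<phi>_def p_def)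
  moreover have "discretization N f (x - axis i 1) = \<phi> (- (1 / real N))"
  proof -
    have "x - axis i 1 = x + axis i (- 1)" by (simp add: vec_eq_iff axis_def)
    thus ?thesis by (simp only: discretization_def grid_point_add_axis \<phi>_def p_def) simp
  qed
  ultimately show ?thesis by (simp add: power_divide)
qed

section \<open>Decay of the Fourier coefficients\<close>

text \<open>Jordan's inequality: on \<open>[0, \<pi>/2]\<close> the concave function \<open>sin\<close> lies above its chord.\<close>

lemma sin_ge_linear:
  assumes "0 \<le> t" "t \<le> 1/2"
  shows "2 * t \<le> sin (pi * t)"
proof -
  have "convex_on {0..pi} (\<lambda>x. - sin x)"
    by (rule f''_ge0_imp_convex[where f' = "\<lambda>x. - cos x" and f'' = sin])
       (auto intro!: derivative_eq_intros simp: sin_ge_zero)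
  from convex_onD[OF this, of "2 * t" 0 "pi/2"] assms show ?thesis
    by (simp add: mult.commute)
qed

text \<open>The distance from \<open>a\<close> to the nearest multiple of \<open>N\<close>, for \<open>0 \<le> a \<le> N\<close>. It is the size of the
frequency \<open>a\<close> when residues are represented symmetrically around 0.\<close>

definition circ_dist :: "nat \<Rightarrow> int \<Rightarrow> int" where
  "circ_dist N a = min a (int N - a)"

lemma sin_ge_circ_dist:
  assumes "0 \<le> a" "a < int N"
  shows "2 * of_int (circ_dist N a) / real N \<le> sin (pi * of_int a / real N)"
proof -
  have N: "real N > 0" using assms by linarith
  define t where "t = real_of_int a / real N"
  have t: "0 \<le> t" "t \<le> 1" using assms N by (auto simp: t_def)
  have "2 * min t (1 - t) \<le> sin (pi * t)"
  proof (cases "t \<le> 1/2")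
    case True
    thus ?thesis using sin_ge_linear[of t] t by simp
  next
    case False
    moreover have "sin (pi * (1 - t)) = sin (pi * t)"
      by (simp add: right_diff_distrib sin_diff)
    ultimately show ?thesis using sin_ge_linear[of "1 - t"] t by simp
  qed
  moreover have "of_int (circ_dist N a) / real N = min t (1 - t)"
    using N by (simp add: circ_dist_def t_def min_divide_distrib_right of_int_min diff_divide_distrib)
  ultimately show ?thesis by (simp add: t_def)
qed

text \<open>By summation by parts in direction \<open>i\<close>, \<open>4 (sin (\<pi> m\<^sub>i / N))\<^sup>2\<close> times the Fourier sum is, up to
sign, a sum of \<open>N\<^sup>d\<close> second differences with unimodular weights, each at most \<open>C_norm 2 f / N\<^sup>2\<close>. Since the sine is at least
\<open>2 w / N\<close> for the size \<open>w\<close> of \<open>m\<^sub>i\<close>, the powers of \<open>N\<close> cancel and the decay is of order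
\<open>w\<^bsup>-2\<^esup>\<close>.\<close>

lemma cmod_dft_sum_discretization_le:
  fixes f :: "real^'n::finite \<Rightarrow> real"
  assumes N: "N > 0" and f: "class_C 2 f" and per: "periodic f"
    and m: "m \<in> grid N" and mi: "m $ i \<noteq> 0"
  shows "cmod (dft_sum N (\<lambda>x. complex_of_real (discretization N f x)) m)
     \<le> (real N ^ CARD('n) * C_norm 2 f / 16) / (of_int (circ_dist N (m $ i)))\<^sup>2"
proof -
  let ?g = "discretization N f"
  let ?h = "\<lambda>x. complex_of_real (?g x)"
  define w where "w = real_of_int (circ_dist N (m $ i))"
  define s where "s = sin (pi * of_int (m $ i) / real N)"
  define S where "S = cmod (dft_sum N ?h m)"
  have a: "0 \<le> m $ i" "m $ i < int N" using m by (auto simp: grid_def)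
  hence w: "w > 0" using mi by (auto simp: w_def circ_dist_def)
  have "4 * s\<^sup>2 * S = cmod (dft_sum N (\<lambda>x. ?h (x + axis i 1) - 2 * ?h x + ?h (x - axis i 1)) m)"
    by (subst dft_sum_second_difference[OF N])
       (simp_all add: discretization_periodic[OF N per] norm_mult s_def S_def norm_power)
  also have "\<dots> \<le> (\<Sum>x\<in>(grid N :: (int^'n) set). C_norm 2 f / (real N)\<^sup>2)"
    unfolding dft_sum_def
  proof (rule sum_norm_le)
    fix x :: "int^'n" assume x: "x \<in> grid N"
    have "cmod (?h (x + axis i 1) - 2 * ?h x + ?h (x - axis i 1))
        = \<bar>?g (x + axis i 1) - 2 * ?g x + ?g (x - axis i 1)\<bar>"
      by (subst norm_of_real[symmetric, where 'a = complex]) simp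
    thus "cmod (dchar N x m * (?h (x + axis i 1) - 2 * ?h x + ?h (x - axis i 1)))
        \<le> C_norm 2 f / (real N)\<^sup>2"
      using discretization_second_difference_le[OF N f per x, of i] by (simp add: norm_mult)
  qed
  also have "\<dots> = real N ^ CARD('n) * C_norm 2 f / (real N)\<^sup>2" by (simp add: card_grid)
  finally have 1: "4 * s\<^sup>2 * S \<le> real N ^ CARD('n) * C_norm 2 f / (real N)\<^sup>2" .
  have "2 * w / real N \<le> s" unfolding w_def s_def by (rule sin_ge_circ_dist[OF a])
  hence "(2 * w / real N)\<^sup>2 \<le> s\<^sup>2" using w by (intro power_mono) auto
  hence "4 * (2 * w / real N)\<^sup>2 * S \<le> 4 * s\<^sup>2 * S"
    by (intro mult_right_mono) (auto simp: S_def)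
  with 1 have "4 * (2 * w / real N)\<^sup>2 * S \<le> real N ^ CARD('n) * C_norm 2 f / (real N)\<^sup>2"
    by linarith
  hence "(16 * w\<^sup>2 * S) / (real N)\<^sup>2 \<le> real N ^ CARD('n) * C_norm 2 f / (real N)\<^sup>2"
    by (simp add: power_divide power_mult_distrib)
  hence "16 * w\<^sup>2 * S \<le> real N ^ CARD('n) * C_norm 2 f"
    using N by (simp add: divide_le_cancel)
  thus ?thesis using w by (simp add: S_def w_def field_simps)
qed

section \<open>Summing the decay over the lattice of frequencies\<close>

lemma card_circ_dist_le:
  assumes "1 \<le> k"
  shows "card {b. 0 \<le> b \<and> b < int N \<and> circ_dist N b \<le> k} \<le> nat (3 * k)"
proof -
  have "card {b. 0 \<le> b \<and> b < int N \<and> circ_dist N b \<le> k} \<le> card ({0..k} \<union> {int N - k..<int N})"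
    by (rule card_mono) (auto simp: circ_dist_def)
  also have "\<dots> \<le> card {0..k} + card {int N - k..<int N}" by (rule card_Un_le)
  also have "\<dots> \<le> nat (3 * k)" using assms by simp
  finally show ?thesis .
qed

text \<open>Fix the value \<open>a\<close> of the dominant coordinate \<open>m\<^sub>i\<close>, of size \<open>k\<close>. Each of the other \<open>d - 1\<close>
coordinates has size at most \<open>k\<close>, which leaves at most \<open>2 k + 1 \<le> 3 k\<close> residues for it.\<close>

lemma sum_dominant_coordinate_le:
  fixes i :: "'n::finite"
  assumes c: "c \<ge> 0"
  shows "(\<Sum>m | (m::int^'n) \<in> grid N \<and> m $ i \<noteq> 0 \<and> (\<forall>j. circ_dist N (m $ j) \<le> circ_dist N (m $ i)).
            c / (of_int (circ_dist N (m $ i)))\<^sup>2)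
       \<le> c * 3 ^ (CARD('n) - 1) *
          (\<Sum>a\<in>{1..<int N}. real_of_int (circ_dist N a) ^ (CARD('n) - 1) / (of_int (circ_dist N a))\<^sup>2)"
proof -
  define P where "P = {m::int^'n. m \<in> grid N \<and> m $ i \<noteq> 0 \<and> (\<forall>j. circ_dist N (m $ j) \<le> circ_dist N (m $ i))}"
  have P: "finite P" unfolding P_def by (rule finite_subset[OF _ finite_grid[of N]]) auto
  have img: "(\<lambda>m. m $ i) ` P \<subseteq> {1..<int N}"
    by (auto simp: P_def grid_def) (metis int_one_le_iff_zero_less le_less)
  have "(\<Sum>m\<in>P. c / (of_int (circ_dist N (m $ i)))\<^sup>2)
      = (\<Sum>a\<in>{1..<int N}. \<Sum>m | m \<in> P \<and> m $ i = a. c / (of_int (circ_dist N (m $ i)))\<^sup>2)"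
    by (rule sum.group[OF P _ img, symmetric]) simp
  also have "\<dots> \<le> (\<Sum>a\<in>{1..<int N}. c * 3 ^ (CARD('n) - 1) *
      (real_of_int (circ_dist N a) ^ (CARD('n) - 1) / (of_int (circ_dist N a))\<^sup>2))"
  proof (rule sum_mono)
    fix a assume a: "a \<in> {1..<int N}"
    define k where "k = circ_dist N a"
    have k: "1 \<le> k" using a by (auto simp: k_def circ_dist_def)
    define B where "B = (\<lambda>j. if j = i then {a} else {b. 0 \<le> b \<and> b < int N \<and> circ_dist N b \<le> k})"
    have "{m. m \<in> P \<and> m $ i = a} \<subseteq> {m. \<forall>j. m $ j \<in> B j}"
      by (auto simp: P_def B_def k_def grid_def)
    moreover have fin: "finite {m. \<forall>j. m $ j \<in> B j}"
    proof (rule finite_subset[OF _ finite_grid[of N]])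
      show "{m. \<forall>j. m $ j \<in> B j} \<subseteq> grid N"
      proof (clarsimp simp: grid_def)
        fix m j assume "\<forall>j. m $ j \<in> B j"
        hence "m $ j \<in> B j" by blast
        thus "0 \<le> m $ j \<and> m $ j < int N" using a by (auto simp: B_def split: if_splits)
      qed
    qed
    ultimately have "card {m. m \<in> P \<and> m $ i = a} \<le> card {m. \<forall>j. m $ j \<in> B j}"
      by (rule card_mono[rotated])
    also have "\<dots> = (\<Prod>j\<in>UNIV. card (B j))" by (rule card_box_int)
    also have "\<dots> = (\<Prod>j\<in>UNIV - {i}. card (B j))"
      by (subst prod.remove[of UNIV i]) (auto simp: B_def)
    also have "\<dots> \<le> (\<Prod>j\<in>UNIV - {i}. nat (3 * k))"
      by (rule prod_mono) (use card_circ_dist_le[OF k, of N] in \<open>auto simp: B_def\<close>)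
    also have "\<dots> = nat (3 * k) ^ (CARD('n) - 1)" by simp
    finally have "real (card {m. m \<in> P \<and> m $ i = a}) \<le> real (nat (3 * k) ^ (CARD('n) - 1))"
      by (rule of_nat_mono)
    also have "\<dots> = 3 ^ (CARD('n) - 1) * of_int k ^ (CARD('n) - 1)"
      using k by (simp add: power_mult_distrib)
    finally have card: "real (card {m. m \<in> P \<and> m $ i = a}) \<le> \<dots>" .
    have "(\<Sum>m | m \<in> P \<and> m $ i = a. c / (of_int (circ_dist N (m $ i)))\<^sup>2)
        = (\<Sum>m | m \<in> P \<and> m $ i = a. c / (of_int k)\<^sup>2)"
      by (rule sum.cong) (auto simp: k_def)
    also have "\<dots> = real (card {m. m \<in> P \<and> m $ i = a}) * (c / (of_int k)\<^sup>2)" by simp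
    also have "\<dots> \<le> 3 ^ (CARD('n) - 1) * of_int k ^ (CARD('n) - 1) * (c / (of_int k)\<^sup>2)"
      by (rule mult_right_mono[OF card]) (use c in simp)
    finally show "(\<Sum>m | m \<in> P \<and> m $ i = a. c / (of_int (circ_dist N (m $ i)))\<^sup>2)
       \<le> c * 3 ^ (CARD('n) - 1) * (real_of_int (circ_dist N a) ^ (CARD('n) - 1) / (of_int (circ_dist N a))\<^sup>2)"
      by (simp add: k_def mult_ac)
  qed
  finally show ?thesis by (simp add: P_def sum_distrib_left)
qed

text \<open>The size of \<open>a\<close> is either \<open>a\<close> or \<open>N - a\<close>, and both run through \<open>1, \<dots>, N - 1\<close>.\<close>

lemma sum_circ_dist_le:
  fixes \<phi> :: "real \<Rightarrow> real"
  assumes \<phi>: "\<And>x. x \<ge> 0 \<Longrightarrow> \<phi> x \<ge> 0"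
  shows "(\<Sum>a\<in>{1..<int N}. \<phi> (of_int (circ_dist N a))) \<le> 2 * (\<Sum>a\<in>{1..<N}. \<phi> (real a))"
proof -
  have "(\<Sum>a\<in>{1..<int N}. \<phi> (of_int (circ_dist N a)))
      \<le> (\<Sum>a\<in>{1..<int N}. \<phi> (of_int a) + \<phi> (of_int (int N - a)))"
  proof (rule sum_mono)
    fix a assume "a \<in> {1..<int N}"
    hence "\<phi> (of_int a) \<ge> 0" "\<phi> (of_int (int N - a)) \<ge> 0" by (auto intro!: \<phi>)
    thus "\<phi> (of_int (circ_dist N a)) \<le> \<phi> (of_int a) + \<phi> (of_int (int N - a))"
      unfolding circ_dist_def min_def by (cases "a \<le> int N - a") auto
  qed
  also have "\<dots> = (\<Sum>a\<in>{1..<int N}. \<phi> (of_int a)) + (\<Sum>a\<in>{1..<int N}. \<phi> (of_int (int N - a)))"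
    by (rule sum.distrib)
  also have "(\<Sum>a\<in>{1..<int N}. \<phi> (of_int (int N - a))) = (\<Sum>a\<in>{1..<int N}. \<phi> (of_int a))"
    by (rule sum.reindex_bij_witness[where i = "\<lambda>a. int N - a" and j = "\<lambda>a. int N - a"]) auto
  also have "(\<Sum>a\<in>{1..<int N}. \<phi> (of_int a)) = (\<Sum>a\<in>{1..<N}. \<phi> (real a))"
    by (rule sum.reindex_bij_witness[where i = int and j = nat]) auto
  finally show ?thesis by simp
qed

text \<open>This sum is where \<open>S_growth\<close> comes from: the terms are \<open>a\<^bsup>d-3\<^esup>\<close>, so that the sum converges for
\<open>d = 1\<close>, is a harmonic number for \<open>d = 2\<close>, and has fewer than \<open>N\<close> terms of size at most
\<open>N\<^bsup>d-3\<^esup>\<close> for \<open>d \<ge> 3\<close>.\<close>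

lemma sum_radial_le_S_growth:
  assumes d: "d \<ge> 1" and N: "N \<ge> 2"
  shows "(\<Sum>a\<in>{1..<N}. real a ^ (d - 1) / (real a)\<^sup>2) \<le> 3 * S_growth d N"
proof -
  consider "d = 1" | "d = 2" | "d \<ge> 3" using d by linarith
  thus ?thesis
  proof cases
    case 1
    have "(\<Sum>a\<in>{1..<Suc (Suc n)}. 1 / (real a)\<^sup>2) \<le> 2 - 1 / real (Suc n)" for n
    proof (induction n)
      case (Suc n)
      \<comment> \<open>Compare the squares with the telescoping series of \<open>1 / (k (k + 1))\<close>.\<close>
      have "1 / (real (Suc (Suc n)))\<^sup>2 \<le> 1 / real (Suc n) - 1 / real (Suc (Suc n))"
      proof -
        have "1 / (real (Suc (Suc n)))\<^sup>2 \<le> 1 / (real (Suc n) * real (Suc (Suc n)))"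
          unfolding power2_eq_square by (intro divide_left_mono mult_right_mono) auto
        also have "\<dots> = 1 / real (Suc n) - 1 / real (Suc (Suc n))"
          by (simp add: field_simps)
        finally show ?thesis .
      qed
      with Suc show ?case by (subst sum.atLeastLessThan_Suc) auto
    qed simp
    from this[of "N - 2"] have "(\<Sum>a\<in>{1..<N}. 1 / (real a)\<^sup>2) \<le> 2 - 1 / real (N - 1)"
      using N by (simp add: numeral_2_eq_2 Suc_diff_Suc)
    also have "\<dots> \<le> 2" by simp
    finally show ?thesis using 1 by (simp add: S_growth_def)
  next
    case 2
    have "(\<Sum>a\<in>{1..<N}. real a ^ (d - 1) / (real a)\<^sup>2) = harm (N - 1)"
    proof -
      have "{1..<N} = {1..N - 1}" using N by auto
      thus ?thesis using 2 by (simp add: harm_def power2_eq_square divide_simps)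
    qed
    also have "\<dots> \<le> 1 + ln (real (N - 1))"
    proof -
      have "1 \<le> N - 1" using N by simp
      from euler_mascheroni_sequence_decreasing[OF _ this] show ?thesis by (simp add: harm_def)
    qed
    also have "ln (real (N - 1)) \<le> ln (real N)" using N by simp
    also have "1 + ln (real N) \<le> 3 * ln (real N)"
    proof -
      have "ln 2 \<le> ln (real N)" using N by simp
      thus ?thesis using ln2_ge_two_thirds by linarith
    qed
    finally show ?thesis using 2 by (simp add: S_growth_def)
  next
    case 3
    have "(\<Sum>a\<in>{1..<N}. real a ^ (d - 1) / (real a)\<^sup>2) \<le> (\<Sum>a\<in>{1..<N}. real N ^ (d - 3))"
    proof (rule sum_mono)
      fix a assume a: "a \<in> {1..<N}"
      have "d - 1 = (d - 3) + 2" using 3 by simp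
      hence "real a ^ (d - 1) = real a ^ (d - 3) * (real a)\<^sup>2"
        by (metis power_add)
      hence "real a ^ (d - 1) / (real a)\<^sup>2 = real a ^ (d - 3)"
        using a by simp
      also have "\<dots> \<le> real N ^ (d - 3)" using a by (intro power_mono) auto
      finally show "real a ^ (d - 1) / (real a)\<^sup>2 \<le> real N ^ (d - 3)" .
    qed
    also have "\<dots> = real (N - 1) * real N ^ (d - 3)" by simp
    also have "\<dots> \<le> real N * real N ^ (d - 3)" by (intro mult_right_mono) auto
    also have "\<dots> = real N ^ (d - 2)"
    proof -
      have "d - 2 = Suc (d - 3)" using 3 by simp
      thus ?thesis by simp
    qed
    also have "\<dots> \<le> 3 * real N ^ (d - 2)" by simp
    finally show ?thesis using 3 by (simp add: S_growth_def)
  qed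
qed

lemma S_growth_ge_half:
  assumes N: "N \<ge> 2"
  shows "S_growth d N \<ge> 1 / 2"
proof -
  have "ln 2 \<le> ln (real N)" using N by simp
  hence "1 / 2 \<le> ln (real N)" using ln2_ge_two_thirds by linarith
  moreover have "1 \<le> real N ^ (d - 2)" using N by (intro one_le_power) auto
  ultimately show ?thesis by (auto simp: S_growth_def)
qed

text \<open>If the terms decay quadratically in every coordinate, use for each frequency the decay in a
coordinate of maximal size, and sum separately over the frequencies with a given dominant
coordinate.\<close>

lemma sum_grid_inverse_square_le:
  fixes B :: "int^'n::finite \<Rightarrow> real"
  assumes N: "N \<ge> 2" and c: "c \<ge> 0"
    and B: "\<And>m i. m \<in> grid N \<Longrightarrow> m $ i \<noteq> 0 \<Longrightarrow> B m \<le> c / (of_int (circ_dist N (m $ i)))\<^sup>2"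
  shows "(\<Sum>m\<in>grid N - {0}. B m) \<le> 2 * real CARD('n) * 3 ^ CARD('n) * c * S_growth CARD('n) N"
proof -
  let ?d = "CARD('n)"
  define P where "P = (\<lambda>i. {m::int^'n. m \<in> grid N \<and> m $ i \<noteq> 0 \<and> (\<forall>j. circ_dist N (m $ j) \<le> circ_dist N (m $ i))})"
  define t where "t = (\<lambda>(m::int^'n) i. c / (of_int (circ_dist N (m $ i)))\<^sup>2)"
  have "(\<Sum>m\<in>grid N - {0}. B m) \<le> (\<Sum>m\<in>grid N - {0}. \<Sum>i\<in>UNIV. if m \<in> P i then t m i else 0)"
  proof (rule sum_mono)
    fix m :: "int^'n" assume m: "m \<in> grid N - {0}"
    then obtain j where j: "m $ j \<noteq> 0" by (auto simp: vec_eq_iff)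
    have "Max (range (\<lambda>j. circ_dist N (m $ j))) \<in> range (\<lambda>j. circ_dist N (m $ j))" by (intro Max_in) auto
    then obtain i where "Max (range (\<lambda>j. circ_dist N (m $ j))) = circ_dist N (m $ i)" by blast
    hence i: "circ_dist N (m $ j) \<le> circ_dist N (m $ i)" for j
      using Max_ge[of "range (\<lambda>j. circ_dist N (m $ j))" "circ_dist N (m $ j)"] by auto
    have "0 \<le> m $ j \<and> m $ j < int N" for j using m by (auto simp: grid_def)
    from this[of j] j have "0 < circ_dist N (m $ j)" by (auto simp: circ_dist_def)
    hence "m $ i \<noteq> 0" using i[of j] by (auto simp: circ_dist_def)
    with i m have "m \<in> P i" "B m \<le> t m i" using B by (auto simp: P_def t_def)
    hence "B m \<le> (if m \<in> P i then t m i else 0)" by simp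
    also have "\<dots> \<le> (\<Sum>i\<in>UNIV. if m \<in> P i then t m i else 0)"
      by (rule member_le_sum) (use c in \<open>auto simp: t_def\<close>)
    finally show "B m \<le> (\<Sum>i\<in>UNIV. if m \<in> P i then t m i else 0)" .
  qed
  also have "\<dots> \<le> (\<Sum>m\<in>grid N. \<Sum>i\<in>UNIV. if m \<in> P i then t m i else 0)"
    by (rule sum_mono2) (use c in \<open>auto simp: t_def intro!: sum_nonneg\<close>)
  also have "\<dots> = (\<Sum>i\<in>UNIV. \<Sum>m\<in>grid N. if m \<in> P i then t m i else 0)"
    by (rule sum.swap)
  also have "\<dots> = (\<Sum>i\<in>UNIV. \<Sum>m\<in>P i. t m i)"
  proof (rule sum.cong[OF refl])
    fix i
    have "{m \<in> grid N. m \<in> P i} = P i" by (auto simp: P_def)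
    thus "(\<Sum>m\<in>grid N. if m \<in> P i then t m i else 0) = (\<Sum>m\<in>P i. t m i)"
      by (simp add: sum.inter_filter[symmetric])
  qed
  also have "\<dots> \<le> (\<Sum>i\<in>(UNIV::'n set). c * 3 ^ (?d - 1) * (6 * S_growth ?d N))"
  proof (rule sum_mono)
    fix i :: 'n
    have "(\<Sum>m\<in>P i. t m i) \<le> c * 3 ^ (?d - 1) *
        (\<Sum>a\<in>{1..<int N}. real_of_int (circ_dist N a) ^ (?d - 1) / (of_int (circ_dist N a))\<^sup>2)"
      unfolding P_def t_def by (rule sum_dominant_coordinate_le[OF c])
    also have "\<dots> \<le> c * 3 ^ (?d - 1) * (6 * S_growth ?d N)"
    proof (rule mult_left_mono)
      have "(\<Sum>a\<in>{1..<int N}. real_of_int (circ_dist N a) ^ (?d - 1) / (of_int (circ_dist N a))\<^sup>2)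
         \<le> 2 * (\<Sum>a\<in>{1..<N}. real a ^ (?d - 1) / (real a)\<^sup>2)"
        by (rule sum_circ_dist_le) simp
      thus "(\<Sum>a\<in>{1..<int N}. real_of_int (circ_dist N a) ^ (?d - 1) / (of_int (circ_dist N a))\<^sup>2)
         \<le> 6 * S_growth ?d N"
        using sum_radial_le_S_growth[OF _ N, of ?d] by simp
    qed (use c in simp)
    finally show "(\<Sum>m\<in>P i. t m i) \<le> c * 3 ^ (?d - 1) * (6 * S_growth ?d N)" .
  qed
  also have "\<dots> = 2 * real ?d * (3 * 3 ^ (?d - 1)) * c * S_growth ?d N" by simp
  also have "(3::real) * 3 ^ (?d - 1) = 3 ^ ?d"
    by (simp flip: power_Suc)
  finally show ?thesis .
qed

section \<open>The Fourier ratio\<close>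

text \<open>The zero frequency contributes at most \<open>N\<^sup>d C_norm 2 f\<close>, which is of the right order because
\<open>S_growth\<close> is bounded below; the decay estimate takes care of the others.\<close>

lemma sum_dft_sum_discretization_le:
  fixes f :: "real^'n::finite \<Rightarrow> real"
  assumes N: "N \<ge> 2" and f: "class_C 2 f" and per: "periodic f"
  shows "(\<Sum>m\<in>grid N. cmod (dft_sum N (\<lambda>x. complex_of_real (discretization N f x)) m))
     \<le> real N ^ CARD('n) * (2 + real CARD('n) * 3 ^ CARD('n)) * C_norm 2 f * S_growth CARD('n) N"
proof -
  let ?d = "CARD('n)" and ?h = "\<lambda>x::int^'n. complex_of_real (discretization N f x)"
  let ?K = "C_norm 2 f" and ?S = "S_growth CARD('n) N"
  have N0: "N > 0" using N by simp
  have K: "0 \<le> ?K" by (rule C_norm_nonneg[OF f])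
  have S: "1 \<le> 2 * ?S" using S_growth_ge_half[OF N, of ?d] by linarith
  have "cmod (dft_sum N ?h 0) \<le> (\<Sum>x\<in>(grid N :: (int^'n) set). ?K)"
    unfolding dft_sum_def
    by (rule sum_norm_le)
       (simp add: norm_mult discretization_def abs_le_C_norm[OF f] grid_point_in_cube[OF N0])
  also have "\<dots> = real N ^ ?d * ?K * 1" by (simp add: card_grid)
  also have "\<dots> \<le> real N ^ ?d * ?K * (2 * ?S)" by (rule mult_left_mono[OF S]) (use K in simp)
  finally have zero: "cmod (dft_sum N ?h 0) \<le> real N ^ ?d * ?K * (2 * ?S)" .
  have "(\<Sum>m\<in>grid N - {0}. cmod (dft_sum N ?h m))
      \<le> 2 * real ?d * 3 ^ ?d * (real N ^ ?d * ?K / 16) * ?S"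
    by (rule sum_grid_inverse_square_le[OF N]) 
       (use K cmod_dft_sum_discretization_le[OF N0 f per] in auto)
  also have "\<dots> \<le> real ?d * 3 ^ ?d * (real N ^ ?d * ?K) * ?S"
    using K S by (simp add: field_simps)
  finally have rest: "(\<Sum>m\<in>grid N - {0}. cmod (dft_sum N ?h m))
      \<le> real ?d * 3 ^ ?d * (real N ^ ?d * ?K) * ?S" .
  have "(\<Sum>m\<in>grid N. cmod (dft_sum N ?h m))
      = cmod (dft_sum N ?h 0) + (\<Sum>m\<in>grid N - {0}. cmod (dft_sum N ?h m))"
    by (rule sum.remove[OF finite_grid]) (use N0 in \<open>simp add: grid_def\<close>)
  with zero rest show ?thesis by (simp add: algebra_simps)
qed

lemma L2_cube_norm_nonneg_square:
  fixes f :: "real^'n::finite \<Rightarrow> real"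
  assumes "continuous_on UNIV f"
  shows "0 \<le> L2_cube_norm f" 
    and "(L2_cube_norm f)\<^sup>2 = integral (cbox 0 1) (\<lambda>u. \<bar>f u\<bar>\<^sup>2)"
proof -
  have "continuous_on (cbox 0 1) (\<lambda>u. \<bar>f u\<bar>\<^sup>2)"
    using continuous_on_subset[OF assms] by (intro continuous_intros) auto
  hence "0 \<le> integral (cbox 0 1) (\<lambda>u. \<bar>f u\<bar>\<^sup>2)"
    by (intro integral_nonneg integrable_continuous) auto
  thus "0 \<le> L2_cube_norm f" 
    and "(L2_cube_norm f)\<^sup>2 = integral (cbox 0 1) (\<lambda>u. \<bar>f u\<bar>\<^sup>2)"
    by (simp_all add: L2_cube_norm_def)
qed

theorem proposition4p1:
  fixes C\<^sub>d :: real
  assumes "C\<^sub>d > 0"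
    and "\<And>(N::nat) (F :: real^'n::finite \<Rightarrow> real). N \<ge> 2 \<Longrightarrow> periodic F \<Longrightarrow> class_C 2 F \<Longrightarrow>
      \<bar>1 / real N ^ CARD('n) * (\<Sum>x\<in>grid N. \<bar>F (grid_point N x)\<bar>\<^sup>2)
         - integral (cbox 0 1) (\<lambda>u. \<bar>F u\<bar>\<^sup>2)\<bar> \<le> C\<^sub>d / real N * (C_norm 2 F)\<^sup>2"
  shows "\<exists>C>0. \<forall>(N::nat) (f :: real^'n \<Rightarrow> real).
    N \<ge> 2 \<longrightarrow> (\<exists>x. f x \<noteq> 0) \<longrightarrow> periodic f \<longrightarrow> class_C 2 f \<longrightarrow>
    real N * (L2_cube_norm f)\<^sup>2 \<ge> 4 * C\<^sub>d * (C_norm 2 f)\<^sup>2 \<longrightarrow>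
    fourier_ratio N (\<lambda>x. complex_of_real (discretization N f x))
      \<le> A_init f
        + C * (C_norm 2 f / L2_cube_norm f) * S_growth CARD('n) N
        + C * (C_norm 2 f / L2_cube_norm f) * (1 / real N)"
proof -
  define C0 where "C0 = 2 + real CARD('n) * 3 ^ CARD('n)"
  have C0: "C0 > 0" by (simp add: C0_def add_pos_nonneg)
  have main: "fourier_ratio N (\<lambda>x. complex_of_real (discretization N f x))
      \<le> A_init f + 2 * C0 * (C_norm 2 f / L2_cube_norm f) * S_growth CARD('n) N
        + 2 * C0 * (C_norm 2 f / L2_cube_norm f) * (1 / real N)"
    if N: "N \<ge> 2" and per: "periodic f" and f: "class_C 2 f"
      and large: "real N * (L2_cube_norm f)\<^sup>2 \<ge> 4 * C\<^sub>d * (C_norm 2 f)\<^sup>2"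
    for N :: nat and f :: "real^'n \<Rightarrow> real"
  proof -
    let ?d = "CARD('n)" and ?h = "\<lambda>x. complex_of_real (discretization N f x)"
    define K L S where "K = C_norm 2 f" and "L = L2_cube_norm f" and "S = S_growth CARD('n) N"
    have N0: "N > 0" using N by simp
    have K: "K \<ge> 0" unfolding K_def by (rule C_norm_nonneg[OF f])
    have S: "S > 0" using S_growth_ge_half[OF N, of ?d] by (simp add: S_def)
    note L2 = L2_cube_norm_nonneg_square[OF class_C_imp_continuous[OF f], folded L_def]
    have extra: "0 \<le> A_init f" "0 \<le> 2 * C0 * (K / L) * (1 / real N)"
      using L2(1) K C0 by (simp_all add: A_init_def L_def)
    have "fourier_ratio N ?h \<le> 2 * C0 * (K / L) * S"
    proof (cases "\<forall>x\<in>grid N. ?h x = 0")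
      case True
      \<comment> \<open>This covers \<open>L = 0\<close>, where the right-hand side is 0 by the convention \<open>x / 0 = 0\<close>.\<close>
      thus ?thesis using L2(1) K C0 S by (simp add: fourier_ratio_def)
    next
      case False
      then obtain x where x: "x \<in> grid N" "f (grid_point N x) \<noteq> 0"
        by (auto simp: discretization_def)
      hence "K > 0" using abs_le_C_norm[OF f grid_point_in_cube[OF N0 x(1)]] by (simp add: K_def)
      \<comment> \<open>A nonzero sample makes \<open>K\<close> positive, and then so is \<open>L\<close>, by the size condition.\<close>
      hence "0 < 4 * C\<^sub>d * K\<^sup>2" using assms(1) by simp
      hence "0 < real N * L\<^sup>2" using large by (simp add: K_def L_def)
      hence L: "L > 0" using L2(1) N0 by (cases "L = 0") auto
      define Q where "Q = (\<Sum>x\<in>grid N. (cmod (?h x))\<^sup>2)"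
      define P where "P = real N powr (real ?d / 2)"
      have P: "P > 0" "P\<^sup>2 = real N ^ ?d" "real N powr (- real ?d / 2) = 1 / P"
        using N0 by (simp_all add: P_def power2_eq_square powr_minus_divide
            flip: powr_realpow powr_add)
      have "\<bar>1 / real N ^ ?d * Q - L\<^sup>2\<bar> \<le> C\<^sub>d / real N * K\<^sup>2"
        using assms(2)[OF N per f] L2(2) by (simp add: Q_def K_def discretization_def)
      \<comment> \<open>The size condition says that the quadrature error is at most a quarter of \<open>L\<^sup>2\<close>.\<close>
      moreover have "C\<^sub>d / real N * K\<^sup>2 \<le> L\<^sup>2 / 4"
        using large N0 by (simp add: K_def L_def field_simps)
      ultimately have "L\<^sup>2 / 4 \<le> 1 / real N ^ ?d * Q"
        using zero_le_power2[of L] by linarith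
      hence "(P * (L / 2))\<^sup>2 \<le> Q"
        using P N0 by (simp add: power_mult_distrib power_divide field_simps)
      hence "P * (L / 2) \<le> sqrt Q" by (rule real_le_rsqrt)
      hence low: "P * (L / 2) \<le> lp_norm 2 N (dft N ?h)"
        by (simp add: lp_norm_2_dft[OF N0] Q_def)
      have "lp_norm 1 N (dft N ?h) \<le> 1 / P * (P\<^sup>2 * C0 * K * S)"
        unfolding lp_norm_1_dft P(2,3) C0_def K_def S_def
        by (rule mult_left_mono[OF sum_dft_sum_discretization_le[OF N f per]]) (use P(1) in simp)
      also have "\<dots> = P * (C0 * K * S)" using P(1) by (simp add: power2_eq_square)
      finally have up: "lp_norm 1 N (dft N ?h) \<le> P * (C0 * K * S)" .
      have "fourier_ratio N ?h = lp_norm 1 N (dft N ?h) / lp_norm 2 N (dft N ?h)"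
        unfolding fourier_ratio_def using False by (simp only: if_False)
      also have "\<dots> \<le> P * (C0 * K * S) / (P * (L / 2))"
        by (rule frac_le[OF _ up _ low]) (use P(1) C0 K S L in auto)
      also have "\<dots> = 2 * C0 * (K / L) * S" using P(1) L by (simp add: field_simps)
      finally show ?thesis .
    qed
    thus ?thesis using extra by (simp add: K_def L_def S_def)
  qed
  show ?thesis
  proof (intro exI[of _ "2 * C0"] conjI allI impI)
    show "0 < 2 * C0" using C0 by simp
  qed (rule main)
qed

end
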